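(* Let $k$ be an algebraically closed field, let $A$ be a basic connected finite-dimensional $k$-algebra, let $X$ be a finitely generated left $A$-module, and let $B=A[X]$ be the one-point extension algebra of $A$ by $X$. Let $\mathcal{S}$ be a semibrick in $\operatorname{mod} A$. Then both $\mathcal{S}$ and $\mathcal{S}\cup\{S_a\}$ are semibricks in $\operatorname{mod} B$, where $S_a$ is the simple $B$-module corresponding to the extension point $a$.
   Context: For an algebra $\Lambda$, $\operatorname{mod}\Lambda$ is the category of finitely generated left $\Lambda$-modules. All algebras considered (including $B$) are assumed basic and connected. The one-point extension of $A$ by $X$ is the matrix algebra $B=A[X]=\begin{pmatrix}A&X\\0&k\end{pmatrix}$, with ordinary matrix addition and multiplication induced by the module structure of $X$; the new vertex is called the extension point $a$. Every $B$-module can be written as $\binom{M}{k^n}_f$ with $M\in\operatorname{mod}A$, $n\in\mathbb{N}$ (including $0$) and $f\in\operatorname{Hom}_A(X\otimes_k k^n,M)$; a morphism $\binom{M}{k^n}_f\to\binom{M'}{k^{n'}}_{f'}$ is a pair $(\alpha,\beta)$ with $\alpha\in\operatorname{Hom}_A(M,M')$, $\beta\in\operatorname{Hom}_k(k^n,k^{n'})$ and $\alpha\circ f=f'\circ(X\otimes\beta)$. An $A$-module $M$ is regarded as the $B$-module $\binom{M}{0}_0$. The simple module at $a$ is $S_a=\binom{0}{k}_0$. A semibrick in $\operatorname{mod}\Lambda$ is a set $\mathcal{S}$ of isomorphism classes of modules such that $\operatorname{End}_\Lambda(S)$ is a division $k$-algebra for every $S\in\mathcal{S}$ and $\operatorname{Hom}_\Lambda(S,S')=0$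 for all $S\ne S'$ in $\mathcal{S}$. *)

theory Defs
  imports "HOL-Algebra.Algebraic_Closure"
begin

section \<open>Left modules and algebras\<close>

text \<open>
  The locales \<open>module\<close> and \<open>algebra\<close> of HOL-Algebra require commutative rings.  The following are
  their noncommutative counterparts, on the same records; as for \<open>module\<close>, the fields
  \<open>mult\<close> and \<open>one\<close> of a module record are irrelevant.
\<close>

locale left_module = R?: ring R + M?: abelian_group M
  for R :: "('a, 'r) ring_scheme" (structure) and M :: "('a, 'm, 's) module_scheme" (structure) +
  assumes smult_closed:
      "\<lbrakk>a \<in> carrier R; x \<in> carrier M\<rbrakk> \<Longrightarrow> a \<odot>\<^bsub>M\<^esub> x \<in> carrier M"
    and smult_l_distr:
      "\<lbrakk>a \<in> carrier R; b \<in> carrier R; x \<in> carrier M\<rbrakk> \<Longrightarrow>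
        (a \<oplus> b) \<odot>\<^bsub>M\<^esub> x = a \<odot>\<^bsub>M\<^esub> x \<oplus>\<^bsub>M\<^esub> b \<odot>\<^bsub>M\<^esub> x"
    and smult_r_distr:
      "\<lbrakk>a \<in> carrier R; x \<in> carrier M; y \<in> carrier M\<rbrakk> \<Longrightarrow>
        a \<odot>\<^bsub>M\<^esub> (x \<oplus>\<^bsub>M\<^esub> y) = a \<odot>\<^bsub>M\<^esub> x \<oplus>\<^bsub>M\<^esub> a \<odot>\<^bsub>M\<^esub> y"
    and smult_assoc1:
      "\<lbrakk>a \<in> carrier R; b \<in> carrier R; x \<in> carrier M\<rbrakk> \<Longrightarrow>
        (a \<otimes> b) \<odot>\<^bsub>M\<^esub> x = a \<odot>\<^bsub>M\<^esub> (b \<odot>\<^bsub>M\<^esub> x)"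
    and smult_one:
      "x \<in> carrier M \<Longrightarrow> \<one> \<odot>\<^bsub>M\<^esub> x = x"

locale assoc_algebra = module R M + field R + ring M
  for R :: "('k, 'r) ring_scheme" (structure) and M :: "('k, 'a, 's) module_scheme" (structure) +
  assumes smult_mult_left:
      "\<lbrakk>c \<in> carrier R; x \<in> carrier M; y \<in> carrier M\<rbrakk> \<Longrightarrow>
        (c \<odot>\<^bsub>M\<^esub> x) \<otimes>\<^bsub>M\<^esub> y = c \<odot>\<^bsub>M\<^esub> (x \<otimes>\<^bsub>M\<^esub> y)"
    and smult_mult_right:
      "\<lbrakk>c \<in> carrier R; x \<in> carrier M; y \<in> carrier M\<rbrakk> \<Longrightarrow>
        x \<otimes>\<^bsub>M\<^esub> (c \<odot>\<^bsub>M\<^esub> y) = c \<odot>\<^bsub>M\<^esub> (x \<otimes>\<^bsub>M\<^esub> y)"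

definition fin_gen :: "('a, 'r) ring_scheme \<Rightarrow> ('a, 'm, 's) module_scheme \<Rightarrow> bool" where
  "fin_gen R M \<longleftrightarrow>
     (\<exists>S. finite S \<and> S \<subseteq> carrier M \<and>
        (\<forall>m\<in>carrier M. \<exists>c\<in>S \<rightarrow> carrier R. m = (\<Oplus>\<^bsub>M\<^esub>s\<in>S. c s \<odot>\<^bsub>M\<^esub> s)))"

definition fg_left_module :: "('a, 'r) ring_scheme \<Rightarrow> ('a, 'm, 's) module_scheme \<Rightarrow> bool" where
  "fg_left_module R M \<longleftrightarrow> left_module R M \<and> fin_gen R M"

definition fd_algebra :: "('k, 'r) ring_scheme \<Rightarrow> ('k, 'a, 's) module_scheme \<Rightarrow> bool" where
  "fd_algebra K A \<longleftrightarrow> assoc_algebra K A \<and> fin_gen K A"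

definition division_algebra :: "('k, 'r) ring_scheme \<Rightarrow> ('k, 'a, 's) module_scheme \<Rightarrow> bool" where
  "division_algebra K D \<longleftrightarrow>
     assoc_algebra K D \<and> \<one>\<^bsub>D\<^esub> \<noteq> \<zero>\<^bsub>D\<^esub> \<and> Units D = carrier D - {\<zero>\<^bsub>D\<^esub>}"


section \<open>Homomorphisms and isomorphism classes\<close>

text \<open>
  Homomorphisms are extensional functions (undefined off the carrier), so that equality of
  homomorphisms is equality of HOL functions.
\<close>

definition module_hom ::
  "('a, 'r) ring_scheme \<Rightarrow> ('a, 'm, 's) module_scheme \<Rightarrow> ('a, 'n, 't) module_scheme \<Rightarrow> ('m \<Rightarrow> 'n) set"
  where
  "module_hom R M N =
     {h \<in> carrier M \<rightarrow>\<^sub>E carrier N.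
        (\<forall>x\<in>carrier M. \<forall>y\<in>carrier M. h (x \<oplus>\<^bsub>M\<^esub> y) = h x \<oplus>\<^bsub>N\<^esub> h y) \<and>
        (\<forall>a\<in>carrier R. \<forall>x\<in>carrier M. h (a \<odot>\<^bsub>M\<^esub> x) = a \<odot>\<^bsub>N\<^esub> h x)}"

definition zero_hom :: "('a, 'm, 's) module_scheme \<Rightarrow> ('a, 'n, 't) module_scheme \<Rightarrow> 'm \<Rightarrow> 'n" where
  "zero_hom M N = (\<lambda>x\<in>carrier M. \<zero>\<^bsub>N\<^esub>)"

text \<open>
  The endomorphism algebra of a module \<open>M\<close> over a \<open>K\<close>-algebra \<open>L\<close>; the field acts on \<open>M\<close>
  through \<open>c \<mapsto> c\<cdot>1\<close> in \<open>L\<close>.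
\<close>

definition End_algebra ::
  "('k, 'a, 'r) module_scheme \<Rightarrow> ('a, 'm, 's) module_scheme \<Rightarrow> ('k, 'm \<Rightarrow> 'm) module" where
  "End_algebra L M =
     \<lparr>carrier = module_hom L M M,
      monoid.mult = (\<lambda>f g. compose (carrier M) f g),
      one = (\<lambda>x\<in>carrier M. x),
      ring.zero = zero_hom M M,
      add = (\<lambda>f g. \<lambda>x\<in>carrier M. f x \<oplus>\<^bsub>M\<^esub> g x),
      smult = (\<lambda>c f. \<lambda>x\<in>carrier M. (c \<odot>\<^bsub>L\<^esub> \<one>\<^bsub>L\<^esub>) \<odot>\<^bsub>M\<^esub> f x)\<rparr>"

definition module_iso ::
  "('a, 'r) ring_scheme \<Rightarrow> ('a, 'm, 's) module_scheme \<Rightarrow> ('a, 'n, 't) module_scheme \<Rightarrow> bool" where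
  "module_iso R M N \<longleftrightarrow> (\<exists>h\<in>module_hom R M N. bij_betw h (carrier M) (carrier N))"

text \<open>
  Isomorphism classes are formed among the finitely generated modules whose carrier lies in
  a given type \<open>'m\<close>, which plays the role of a universe.
\<close>

definition iso_class :: "('a, 'r) ring_scheme \<Rightarrow> ('a, 'm) module \<Rightarrow> ('a, 'm) module set" where
  "iso_class R M = {N. fg_left_module R N \<and> module_iso R M N}"

definition iso_classes :: "('a, 'r) ring_scheme \<Rightarrow> ('a, 'm) module set set" where
  "iso_classes R = iso_class R ` {M. fg_left_module R M}"


section \<open>Semibricks\<close>

definition semibrick ::
  "('k, 'r) ring_scheme \<Rightarrow> ('k, 'a, 's) module_scheme \<Rightarrow> ('a, 'm) module set set \<Rightarrow> bool" where
  "semibrick K L \<S> \<longleftrightarrow>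
     \<S> \<subseteq> iso_classes L \<and>
     (\<forall>C\<in>\<S>. \<forall>M\<in>C. division_algebra K (End_algebra L M)) \<and>
     (\<forall>C\<in>\<S>. \<forall>D\<in>\<S>. C \<noteq> D \<longrightarrow> (\<forall>M\<in>C. \<forall>N\<in>D. module_hom L M N = {zero_hom M N}))"


section \<open>Basic and connected algebras\<close>

definition idempotent :: "('a, 'r) ring_scheme \<Rightarrow> 'a \<Rightarrow> bool" where
  "idempotent R e \<longleftrightarrow> e \<in> carrier R \<and> e \<otimes>\<^bsub>R\<^esub> e = e"

definition orthogonal :: "('a, 'r) ring_scheme \<Rightarrow> 'a \<Rightarrow> 'a \<Rightarrow> bool" where
  "orthogonal R e f \<longleftrightarrow> e \<otimes>\<^bsub>R\<^esub> f = \<zero>\<^bsub>R\<^esub> \<and> f \<otimes>\<^bsub>R\<^esub> e = \<zero>\<^bsub>R\<^esub>"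

definition primitive_idempotent :: "('a, 'r) ring_scheme \<Rightarrow> 'a \<Rightarrow> bool" where
  "primitive_idempotent R e \<longleftrightarrow>
     idempotent R e \<and> e \<noteq> \<zero>\<^bsub>R\<^esub> \<and>
     (\<forall>f g. idempotent R f \<and> idempotent R g \<and> orthogonal R f g \<and> e = f \<oplus>\<^bsub>R\<^esub> g \<longrightarrow>
        f = \<zero>\<^bsub>R\<^esub> \<or> g = \<zero>\<^bsub>R\<^esub>)"

definition principal_left_module :: "('a, 'r) ring_scheme \<Rightarrow> 'a \<Rightarrow> ('a, 'a) module" where
  "principal_left_module R e =
     \<lparr>carrier = {a \<otimes>\<^bsub>R\<^esub> e | a. a \<in> carrier R}, monoid.mult = undefined, one = undefined,
      ring.zero = \<zero>\<^bsub>R\<^esub>, add = (\<lambda>x y. x \<oplus>\<^bsub>R\<^esub> y), smult = (\<lambda>a x. a \<otimes>\<^bsub>R\<^esub> x)\<rparr>"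

text \<open>
  Basic: there is a complete set of primitive orthogonal idempotents whose indecomposable
  projective left modules are pairwise non-isomorphic.
\<close>

definition basic :: "('a, 'r) ring_scheme \<Rightarrow> bool" where
  "basic R \<longleftrightarrow>
     (\<exists>E. finite E \<and> (\<forall>e\<in>E. primitive_idempotent R e) \<and>
        (\<forall>e\<in>E. \<forall>f\<in>E. e \<noteq> f \<longrightarrow> orthogonal R e f) \<and>
        (\<Oplus>\<^bsub>R\<^esub>e\<in>E. e) = \<one>\<^bsub>R\<^esub> \<and>
        (\<forall>e\<in>E. \<forall>f\<in>E. e \<noteq> f \<longrightarrow>
           \<not> module_iso R (principal_left_module R e) (principal_left_module R f)))"

text \<open>
  Connected: nonzero and not a direct product of two nonzero algebras.  The product
  decomposition is expressed internally, by two complementary two-sided ideals (which are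
  automatically subspaces).
\<close>

definition connected_algebra :: "('a, 'r) ring_scheme \<Rightarrow> bool" where
  "connected_algebra R \<longleftrightarrow>
     \<one>\<^bsub>R\<^esub> \<noteq> \<zero>\<^bsub>R\<^esub> \<and>
     (\<forall>I J. ideal I R \<and> ideal J R \<and> I \<inter> J = {\<zero>\<^bsub>R\<^esub>} \<and> I <+>\<^bsub>R\<^esub> J = carrier R \<longrightarrow>
        I = {\<zero>\<^bsub>R\<^esub>} \<or> J = {\<zero>\<^bsub>R\<^esub>})"


section \<open>One-point extensions and their modules\<close>

text \<open>
  The triple \<open>(a, x, c)\<close> stands for the matrix with rows \<open>(a, x)\<close> and \<open>(0, c)\<close>.  The right
  action of \<open>K\<close> on \<open>V\<close> in the upper right entry \<open>a\<cdot>x' + x\<cdot>c'\<close> of a product is the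
  \<open>K\<close>-space structure \<open>x\<cdot>c' = (c'\<cdot>1)\<cdot>x\<close> of the \<open>A\<close>-module \<open>V\<close>.
  (The extending module is called \<open>V\<close> since \<open>X\<close> with an index is HOL-Algebra's notation for the
  polynomial variable.)
\<close>

definition one_point_extension ::
  "('k, 'r) ring_scheme \<Rightarrow> ('k, 'a, 's) module_scheme \<Rightarrow> ('a, 'x, 't) module_scheme \<Rightarrow>
   ('k, 'a \<times> 'x \<times> 'k) module" where
  "one_point_extension K A V =
     \<lparr>carrier = carrier A \<times> carrier V \<times> carrier K,
      monoid.mult = (\<lambda>(a, x, c) (a', x', c').
        (a \<otimes>\<^bsub>A\<^esub> a', a \<odot>\<^bsub>V\<^esub> x' \<oplus>\<^bsub>V\<^esub> (c' \<odot>\<^bsub>A\<^esub> \<one>\<^bsub>A\<^esub>) \<odot>\<^bsub>V\<^esub> x, c \<otimes>\<^bsub>K\<^esub> c')),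
      one = (\<one>\<^bsub>A\<^esub>, \<zero>\<^bsub>V\<^esub>, \<one>\<^bsub>K\<^esub>),
      ring.zero = (\<zero>\<^bsub>A\<^esub>, \<zero>\<^bsub>V\<^esub>, \<zero>\<^bsub>K\<^esub>),
      add = (\<lambda>(a, x, c) (a', x', c'). (a \<oplus>\<^bsub>A\<^esub> a', x \<oplus>\<^bsub>V\<^esub> x', c \<oplus>\<^bsub>K\<^esub> c')),
      smult = (\<lambda>d (a, x, c). (d \<odot>\<^bsub>A\<^esub> a, (d \<odot>\<^bsub>A\<^esub> \<one>\<^bsub>A\<^esub>) \<odot>\<^bsub>V\<^esub> x, d \<otimes>\<^bsub>K\<^esub> c))\<rparr>"

text \<open>
  The module over the one-point extension with underlying space \<open>M \<times> K\<^sup>n\<close> given by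
  \<open>f : V \<otimes> K\<^sup>n \<rightarrow> M\<close>, where \<open>f x v\<close> is the value at \<open>x \<otimes> v\<close> (so \<open>f\<close> is to be biadditive and
  \<open>K\<close>-balanced, and \<open>A\<close>-linear in \<open>x\<close>):
  the matrix \<open>(a, x, c)\<close> acts on the column \<open>(m, v)\<close> by \<open>(a\<cdot>m + f x v, c\<cdot>v)\<close>.
\<close>

definition triple_module ::
  "('k, 'r) ring_scheme \<Rightarrow> ('a, 'm) module \<Rightarrow> nat \<Rightarrow> ('x \<Rightarrow> (nat \<Rightarrow> 'k) \<Rightarrow> 'm) \<Rightarrow>
   ('a \<times> 'x \<times> 'k, 'm \<times> (nat \<Rightarrow> 'k)) module" where
  "triple_module K M n f =
     \<lparr>carrier = carrier M \<times> ({..<n} \<rightarrow>\<^sub>E carrier K),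
      monoid.mult = undefined, one = undefined,
      ring.zero = (\<zero>\<^bsub>M\<^esub>, \<lambda>i\<in>{..<n}. \<zero>\<^bsub>K\<^esub>),
      add = (\<lambda>(m, v) (m', v'). (m \<oplus>\<^bsub>M\<^esub> m', \<lambda>i\<in>{..<n}. v i \<oplus>\<^bsub>K\<^esub> v' i)),
      smult = (\<lambda>(a, x, c) (m, v). (a \<odot>\<^bsub>M\<^esub> m \<oplus>\<^bsub>M\<^esub> f x v, \<lambda>i\<in>{..<n}. c \<otimes>\<^bsub>K\<^esub> v i))\<rparr>"

definition zero_module :: "('a, 'm) module" where
  "zero_module =
     \<lparr>carrier = {undefined}, monoid.mult = undefined, one = undefined, ring.zero = undefined,
      add = (\<lambda>_ _. undefined), smult = (\<lambda>_ _. undefined)\<rparr>"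

definition extend_by_zero ::
  "('k, 'r) ring_scheme \<Rightarrow> ('a, 'm) module \<Rightarrow> ('a \<times> 'x \<times> 'k, 'm \<times> (nat \<Rightarrow> 'k)) module" where
  "extend_by_zero K M = triple_module K M 0 (\<lambda>x v. \<zero>\<^bsub>M\<^esub>)"

definition extension_simple ::
  "('k, 'r) ring_scheme \<Rightarrow> ('a \<times> 'x \<times> 'k, 'm \<times> (nat \<Rightarrow> 'k)) module" where
  "extension_simple K = (let Z = (zero_module :: ('a, 'm) module) in triple_module K Z 1 (\<lambda>x v. \<zero>\<^bsub>Z\<^esub>))"

text \<open>
  A set of isomorphism classes of \<open>A\<close>-modules, regarded as a set of isomorphism classes of
  modules over the one-point extension \<open>B\<close>.
\<close>

definition extend_classes ::
  "('k, 'r) ring_scheme \<Rightarrow> ('k, 'a \<times> 'x \<times> 'k, 's) module_scheme \<Rightarrow> ('a, 'm) module set set \<Rightarrow>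
   ('a \<times> 'x \<times> 'k, 'm \<times> (nat \<Rightarrow> 'k)) module set set" where
  "extend_classes K B \<S> = {iso_class B (extend_by_zero K M) | M C. C \<in> \<S> \<and> M \<in> C}"

end

theory Submission
  imports Defs
begin

text \<open>
  With \<open>e = (1, 0, 0)\<close> and \<open>e' = (0, 0, 1)\<close> in \<open>B\<close>, the \<open>A\<close>-modules are \<open>B\<close>-modules on which \<open>e\<close>
  is the identity, and \<open>e'\<close> is the identity on \<open>S\<^sub>a\<close>; as \<open>e\<close> and \<open>e'\<close> are orthogonal, there are
  no nonzero homomorphisms in either direction.  Everything else is transported along bijections
  that are semilinear over \<open>a \<mapsto> (a, 0, 0)\<close>, or over \<open>c \<mapsto> (0, 0, c)\<close> in the case of
  \<open>S\<^sub>a\<close>, where \<open>K\<close> itself is the brick one starts from.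
\<close>

section \<open>Homomorphisms and bricks\<close>

text \<open>The map \<open>\<sigma>\<close> only goes from the small ring into \<open>B\<close>. A
  \<open>B\<close>-homomorphism pulled back along it is linear over the small ring (restriction of
  scalars), so vanishing of Hom spaces and bijectivity of nonzero endomorphisms pass to the
  \<open>B\<close>-side without lifting any homomorphism. Lifting occurs once, for isomorphisms, to
  see that different classes over \<open>B\<close> come from different members of
  \<open>\<S>\<close>.

  An isomorphism class over \<open>B\<close> contains every finitely generated module on the given
  type that is isomorphic to \<open>ext M\<close> or \<open>S_a\<close>, and the semibrick
  conditions speak about all of them. The bijections are therefore composed with an isomorphism, so
  that they end in an arbitrary representative. The identity actions of \<open>e\<close> and
  \<open>e'\<close> survive this, because they too are transported, from the unit of the small ring.

  The division algebra condition is first replaced by \<open>brick\<close>, a condition on maps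
  alone, so that no isomorphism between endomorphism algebras over two different rings has to be
  built.\<close>

lemma module_homI:
  assumes "h \<in> carrier M \<rightarrow>\<^sub>E carrier N"
    and "\<And>x y. x \<in> carrier M \<Longrightarrow> y \<in> carrier M \<Longrightarrow> h (x \<oplus>\<^bsub>M\<^esub> y) = h x \<oplus>\<^bsub>N\<^esub> h y"
    and "\<And>a x. a \<in> carrier R \<Longrightarrow> x \<in> carrier M \<Longrightarrow> h (a \<odot>\<^bsub>M\<^esub> x) = a \<odot>\<^bsub>N\<^esub> h x"
  shows "h \<in> module_hom R M N"
  using assms by (auto simp: module_hom_def)

lemma module_homD:
  assumes "h \<in> module_hom R M N"
  shows "h \<in> extensional (carrier M)"
    and "x \<in> carrier M \<Longrightarrow> h x \<in> carrier N"
    and "x \<in> carrier M \<Longrightarrow> y \<in> carrier M \<Longrightarrow> h (x \<oplus>\<^bsub>M\<^esub> y) = h x \<oplus>\<^bsub>N\<^esub> h y"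
    and "a \<in> carrier R \<Longrightarrow> x \<in> carrier M \<Longrightarrow> h (a \<odot>\<^bsub>M\<^esub> x) = a \<odot>\<^bsub>N\<^esub> h x"
  using assms by (auto simp: module_hom_def PiE_def)

text \<open>Stated without scalars, so that it covers \<open>a \<odot> x\<close> in each of its two
  arguments as well as semilinear maps.\<close>

lemma additive_zero:
  assumes "abelian_group M" "abelian_group N"
    and "\<And>x. x \<in> carrier M \<Longrightarrow> h x \<in> carrier N"
    and "\<And>x y. x \<in> carrier M \<Longrightarrow> y \<in> carrier M \<Longrightarrow> h (x \<oplus>\<^bsub>M\<^esub> y) = h x \<oplus>\<^bsub>N\<^esub> h y"
  shows "h \<zero>\<^bsub>M\<^esub> = \<zero>\<^bsub>N\<^esub>"
proof -
  interpret M: abelian_group M by fact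
  interpret N: abelian_group N by fact
  have "h \<zero>\<^bsub>M\<^esub> \<oplus>\<^bsub>N\<^esub> h \<zero>\<^bsub>M\<^esub> = h \<zero>\<^bsub>M\<^esub>"
    using assms(4)[of "\<zero>\<^bsub>M\<^esub>" "\<zero>\<^bsub>M\<^esub>"] by simp
  then show ?thesis
    using assms(3)[of "\<zero>\<^bsub>M\<^esub>"] by (simp add: N.add.l_cancel_one')
qed

context left_module
begin

lemma smult_r_null:
  assumes "a \<in> carrier R"
  shows "a \<odot>\<^bsub>M\<^esub> \<zero>\<^bsub>M\<^esub> = \<zero>\<^bsub>M\<^esub>"
  by (rule additive_zero) (use assms in \<open>auto simp: smult_closed smult_r_distr M.abelian_group_axioms\<close>)

lemma smult_l_null:
  assumes "x \<in> carrier M"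
  shows "\<zero> \<odot>\<^bsub>M\<^esub> x = \<zero>\<^bsub>M\<^esub>"
  using additive_zero[of R M "\<lambda>a. a \<odot>\<^bsub>M\<^esub> x"] assms
  by (auto simp: smult_closed smult_l_distr M.abelian_group_axioms R.abelian_group_axioms)

lemma smult_minus:
  assumes "a \<in> carrier R" "x \<in> carrier M"
  shows "a \<odot>\<^bsub>M\<^esub> (\<ominus>\<^bsub>M\<^esub> x) = \<ominus>\<^bsub>M\<^esub> (a \<odot>\<^bsub>M\<^esub> x)"
proof (rule M.minus_equality[symmetric])
  show "a \<odot>\<^bsub>M\<^esub> (\<ominus>\<^bsub>M\<^esub> x) \<oplus>\<^bsub>M\<^esub> a \<odot>\<^bsub>M\<^esub> x = \<zero>\<^bsub>M\<^esub>"
    using assms by (simp add: smult_r_distr[symmetric] M.l_neg smult_r_null)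
qed (use assms in \<open>auto simp: smult_closed\<close>)

end

section \<open>Zero homomorphisms and vanishing Hom spaces\<close>

lemma zero_hom_in_module_hom:
  assumes "left_module R M" "left_module R N"
  shows "zero_hom M N \<in> module_hom R M N"
proof -
  interpret M: left_module R M by fact
  interpret N: left_module R N by fact
  show ?thesis
    by (rule module_homI) (auto simp: zero_hom_def M.smult_closed N.smult_r_null)
qed

lemma module_hom_eq_zeroI:
  assumes "left_module R M" "left_module R N"
    and "\<And>h x. h \<in> module_hom R M N \<Longrightarrow> x \<in> carrier M \<Longrightarrow> h x = \<zero>\<^bsub>N\<^esub>"
  shows "module_hom R M N = {zero_hom M N}"
proof -
  have "h = zero_hom M N" if h: "h \<in> module_hom R M N" for h
    by (rule extensionalityI[of _ "carrier M"])
      (auto simp: zero_hom_def module_homD(1)[OF h] assms(3)[OF h])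
  then show ?thesis
    using zero_hom_in_module_hom[OF assms(1,2)] by blast
qed

text \<open>Linearity carries \<open>e\<close> through \<open>h\<close>:
  \<open>h x = h (e x) = e (h x) = e (f (h x)) = (e f) (h x) = 0\<close>. One order of the product
  settles one direction; the other direction takes the product \<open>f e\<close>.\<close>

lemma module_hom_orthogonal_idempotents:
  assumes "left_module R M" "left_module R N"
    and e: "e \<in> carrier R" "f \<in> carrier R" "e \<otimes>\<^bsub>R\<^esub> f = \<zero>\<^bsub>R\<^esub>"
    and M: "\<And>x. x \<in> carrier M \<Longrightarrow> e \<odot>\<^bsub>M\<^esub> x = x"
    and N: "\<And>y. y \<in> carrier N \<Longrightarrow> f \<odot>\<^bsub>N\<^esub> y = y"
  shows "module_hom R M N = {zero_hom M N}"
proof (rule module_hom_eq_zeroI[OF assms(1,2)])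
  interpret N: left_module R N by fact
  fix h x assume h: "h \<in> module_hom R M N" and x: "x \<in> carrier M"
  have hx: "h x \<in> carrier N" using h x by (rule module_homD)
  have "h x = e \<odot>\<^bsub>N\<^esub> h x"
    using module_homD(4)[OF h e(1) x] M[OF x] by simp
  also have "\<dots> = e \<odot>\<^bsub>N\<^esub> (f \<odot>\<^bsub>N\<^esub> h x)"
    using N[OF hx] by simp
  also have "\<dots> = \<zero>\<^bsub>N\<^esub>"
    using N.smult_assoc1[OF e(1,2) hx] e(3) N.smult_l_null[OF hx] by simp
  finally show "h x = \<zero>\<^bsub>N\<^esub>" .
qed

section \<open>Composition, inverses and isomorphism classes\<close>

lemma compose_in_module_hom:
  assumes f: "f \<in> module_hom R N P" and g: "g \<in> module_hom R M N" and M: "left_module R M"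
  shows "compose (carrier M) f g \<in> module_hom R M P"
proof -
  interpret M: left_module R M by fact
  show ?thesis
    by (rule module_homI)
      (auto simp: compose_def M.smult_closed module_homD[OF f] module_homD[OF g])
qed

lemma inv_into_in_module_hom:
  assumes h: "h \<in> module_hom R M N" and bij: "bij_betw h (carrier M) (carrier N)"
    and M: "left_module R M" and N: "left_module R N"
  shows "(\<lambda>y\<in>carrier N. inv_into (carrier M) h y) \<in> module_hom R N M"
proof -
  interpret M: left_module R M by fact
  interpret N: left_module R N by fact
  let ?g = "inv_into (carrier M) h"
  have g: "?g y \<in> carrier M" "h (?g y) = y" if "y \<in> carrier N" for y
    using bij that by (auto simp: bij_betw_def inv_into_into f_inv_into_f)
  \<comment> \<open>A value of the inverse is identified by exhibiting a preimage, which reduces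
    linearity of \<open>?g\<close> to that of \<open>h\<close>.\<close>
  have eq: "?g y = x" if "x \<in> carrier M" "h x = y" for x y
    using bij that by (auto simp: bij_betw_def inv_into_f_f)
  show ?thesis
  proof (rule module_homI)
    show "restrict ?g (carrier N) \<in> carrier N \<rightarrow>\<^sub>E carrier M"
      using g by auto
  next
    fix x y assume "x \<in> carrier N" "y \<in> carrier N"
    then show "restrict ?g (carrier N) (x \<oplus>\<^bsub>N\<^esub> y) =
        restrict ?g (carrier N) x \<oplus>\<^bsub>M\<^esub> restrict ?g (carrier N) y"
      by (simp add: eq g module_homD[OF h])
  next
    fix a x assume "a \<in> carrier R" "x \<in> carrier N"
    then show "restrict ?g (carrier N) (a \<odot>\<^bsub>N\<^esub> x) = a \<odot>\<^bsub>M\<^esub> restrict ?g (carrier N) x"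
      by (simp add: eq g module_homD[OF h] M.smult_closed N.smult_closed)
  qed
qed

lemma module_isoI:
  "h \<in> module_hom R M N \<Longrightarrow> bij_betw h (carrier M) (carrier N) \<Longrightarrow> module_iso R M N"
  by (auto simp: module_iso_def)

lemma module_iso_sym:
  assumes "module_iso R M N" "left_module R M" "left_module R N"
  shows "module_iso R N M"
proof -
  obtain h where h: "h \<in> module_hom R M N" "bij_betw h (carrier M) (carrier N)"
    using assms(1) by (auto simp: module_iso_def)
  have "bij_betw (\<lambda>y\<in>carrier N. inv_into (carrier M) h y) (carrier N) (carrier M)"
    using bij_betw_inv_into[OF h(2)] by (simp cong: bij_betw_cong)
  then show ?thesis
    using inv_into_in_module_hom[OF h assms(2,3)] by (intro module_isoI)
qed

lemma module_iso_trans: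
  assumes "module_iso R M N" "module_iso R N P" "left_module R M"
  shows "module_iso R M P"
proof -
  obtain h g where h: "h \<in> module_hom R M N" "bij_betw h (carrier M) (carrier N)"
    and g: "g \<in> module_hom R N P" "bij_betw g (carrier N) (carrier P)"
    using assms(1,2) by (auto simp: module_iso_def)
  have "bij_betw (compose (carrier M) g h) (carrier M) (carrier P)"
    using h(2) g(2) by (rule bij_betw_compose)
  then show ?thesis
    using compose_in_module_hom[OF g(1) h(1) assms(3)] by (auto simp: module_iso_def)
qed

lemma iso_class_eqI:
  assumes "module_iso R M N" "left_module R M" "left_module R N"
  shows "iso_class R M = iso_class R N"
  using module_iso_trans[OF assms(1)] module_iso_trans[OF module_iso_sym[OF assms]] assms
  by (auto simp: iso_class_def)

text \<open>This is the division property of the endomorphism ring with "unit" read as "bijective".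
  It mentions neither the base field nor the algebra operations, so it makes sense for modules over
  any ring and can be compared across two rings.\<close>

definition brick :: "('a, 'r) ring_scheme \<Rightarrow> ('a, 'm, 's) module_scheme \<Rightarrow> bool" where
  "brick R M \<longleftrightarrow>
     (\<exists>x\<in>carrier M. x \<noteq> \<zero>\<^bsub>M\<^esub>) \<and>
     (\<forall>h\<in>module_hom R M M. h \<noteq> zero_hom M M \<longrightarrow> bij_betw h (carrier M) (carrier M))"

context assoc_algebra
begin

lemma scalar_central:
  assumes "c \<in> carrier R" "a \<in> carrier M"
  shows "(c \<odot>\<^bsub>M\<^esub> \<one>\<^bsub>M\<^esub>) \<otimes>\<^bsub>M\<^esub> a = c \<odot>\<^bsub>M\<^esub> a" "a \<otimes>\<^bsub>M\<^esub> (c \<odot>\<^bsub>M\<^esub> \<one>\<^bsub>M\<^esub>) = c \<odot>\<^bsub>M\<^esub> a"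
  using assms by (simp_all add: smult_mult_left smult_mult_right)

end

section \<open>The endomorphism algebra of a module over an algebra\<close>

locale algebra_module = L: assoc_algebra K L + left_module L M
  for K :: "('k, 'r) ring_scheme" and L :: "('k, 'a, 's) module_scheme"
    and M :: "('a, 'm, 't) module_scheme"
begin

text \<open>The vector space structure on \<open>M\<close> induced by
  \<open>c \<mapsto> c\<cdot>1\<close>. The same expression occurs as scalar multiplication in
  \<open>End_algebra\<close> and as the right action in \<open>one_point_extension\<close>.\<close>

definition scal :: "'k \<Rightarrow> 'm \<Rightarrow> 'm" where
  "scal c x = (c \<odot>\<^bsub>L\<^esub> \<one>\<^bsub>L\<^esub>) \<odot>\<^bsub>M\<^esub> x"

lemma scal_closed: "c \<in> carrier K \<Longrightarrow> x \<in> carrier M \<Longrightarrow> scal c x \<in> carrier M"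
  by (simp add: scal_def smult_closed)

lemma scal_r_distr:
  "c \<in> carrier K \<Longrightarrow> x \<in> carrier M \<Longrightarrow> y \<in> carrier M \<Longrightarrow>
    scal c (x \<oplus>\<^bsub>M\<^esub> y) = scal c x \<oplus>\<^bsub>M\<^esub> scal c y"
  by (simp add: scal_def smult_r_distr)

lemma scal_l_distr:
  "c \<in> carrier K \<Longrightarrow> d \<in> carrier K \<Longrightarrow> x \<in> carrier M \<Longrightarrow>
    scal (c \<oplus>\<^bsub>K\<^esub> d) x = scal c x \<oplus>\<^bsub>M\<^esub> scal d x"
  by (simp add: scal_def smult_l_distr L.smult_l_distr)

lemma scal_mult:
  assumes "c \<in> carrier K" "d \<in> carrier K" "x \<in> carrier M"
  shows "scal (c \<otimes>\<^bsub>K\<^esub> d) x = scal c (scal d x)"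
proof -
  have "(c \<otimes>\<^bsub>K\<^esub> d) \<odot>\<^bsub>L\<^esub> \<one>\<^bsub>L\<^esub> = (c \<odot>\<^bsub>L\<^esub> \<one>\<^bsub>L\<^esub>) \<otimes>\<^bsub>L\<^esub> (d \<odot>\<^bsub>L\<^esub> \<one>\<^bsub>L\<^esub>)"
    using assms by (simp add: L.scalar_central(1) L.smult_assoc1)
  then show ?thesis
    using assms by (simp add: scal_def smult_assoc1)
qed

lemma scal_one: "x \<in> carrier M \<Longrightarrow> scal \<one>\<^bsub>K\<^esub> x = x"
  by (simp add: scal_def smult_one)

lemma scal_zero: "x \<in> carrier M \<Longrightarrow> scal \<zero>\<^bsub>K\<^esub> x = \<zero>\<^bsub>M\<^esub>"
  by (simp add: scal_def L.smult_l_null smult_l_null)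

lemma smult_scal:
  assumes "c \<in> carrier K" "a \<in> carrier L" "x \<in> carrier M"
  shows "a \<odot>\<^bsub>M\<^esub> scal c x = (c \<odot>\<^bsub>L\<^esub> a) \<odot>\<^bsub>M\<^esub> x"
    and "scal c (a \<odot>\<^bsub>M\<^esub> x) = (c \<odot>\<^bsub>L\<^esub> a) \<odot>\<^bsub>M\<^esub> x"
  using assms by (simp_all add: scal_def smult_assoc1[symmetric] L.scalar_central)

lemma hom_scal:
  "h \<in> module_hom L M M \<Longrightarrow> c \<in> carrier K \<Longrightarrow> x \<in> carrier M \<Longrightarrow> h (scal c x) = scal c (h x)"
  by (simp add: scal_def module_homD)

abbreviation (input) E where "E \<equiv> End_algebra L M"

lemma End_simps:
  "carrier E = module_hom L M M"
  "f \<oplus>\<^bsub>E\<^esub> g = (\<lambda>x\<in>carrier M. f x \<oplus>\<^bsub>M\<^esub> g x)"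
  "f \<otimes>\<^bsub>E\<^esub> g = compose (carrier M) f g"
  "\<zero>\<^bsub>E\<^esub> = zero_hom M M"
  "\<one>\<^bsub>E\<^esub> = (\<lambda>x\<in>carrier M. x)"
  "c \<odot>\<^bsub>E\<^esub> f = (\<lambda>x\<in>carrier M. scal c (f x))"
  by (simp_all add: End_algebra_def scal_def)

lemma hom_eqI:
  assumes "f \<in> module_hom L M M" "g \<in> module_hom L M M" "\<And>x. x \<in> carrier M \<Longrightarrow> f x = g x"
  shows "f = g"
  using assms module_homD(1) extensionalityI by metis

lemma End_add_closed:
  assumes "f \<in> module_hom L M M" "g \<in> module_hom L M M"
  shows "(\<lambda>x\<in>carrier M. f x \<oplus>\<^bsub>M\<^esub> g x) \<in> module_hom L M M"
  by (rule module_homI)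
    (auto simp: module_homD[OF assms(1)] module_homD[OF assms(2)] smult_closed smult_r_distr
      M.a_ac)

lemma End_one_closed: "(\<lambda>x\<in>carrier M. x) \<in> module_hom L M M"
  by (rule module_homI) (auto simp: smult_closed)

lemma End_smult_closed:
  assumes "c \<in> carrier K" "f \<in> module_hom L M M"
  shows "(\<lambda>x\<in>carrier M. scal c (f x)) \<in> module_hom L M M"
  by (rule module_homI)
    (auto simp: module_homD[OF assms(2)] smult_closed scal_closed assms(1) scal_r_distr smult_scal)

lemma End_minus_closed:
  assumes "f \<in> module_hom L M M"
  shows "(\<lambda>x\<in>carrier M. \<ominus>\<^bsub>M\<^esub> f x) \<in> module_hom L M M"
  by (rule module_homI)
    (auto simp: module_homD[OF assms] smult_closed smult_minus M.minus_add)

lemmas End_closed = End_add_closed End_one_closed End_smult_closed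
  zero_hom_in_module_hom[OF left_module_axioms left_module_axioms]
  compose_in_module_hom[where N = M and P = M, OF _ _ left_module_axioms]

lemma abelian_group_End: "abelian_group E"
proof (rule abelian_groupI)
  show "\<zero>\<^bsub>E\<^esub> \<in> carrier E"
    by (simp add: End_simps End_closed)
next
  fix f g assume "f \<in> carrier E" "g \<in> carrier E"
  then have f: "f \<in> module_hom L M M" and g: "g \<in> module_hom L M M"
    by (simp_all add: End_simps)
  note D = module_homD(2)[OF f] module_homD(2)[OF g]
  show "f \<oplus>\<^bsub>E\<^esub> g \<in> carrier E"
    using f g by (simp add: End_simps End_closed)
  show "f \<oplus>\<^bsub>E\<^esub> g = g \<oplus>\<^bsub>E\<^esub> f"
    by (auto simp: End_simps D M.a_comm intro: restrict_ext)
  show "\<zero>\<^bsub>E\<^esub> \<oplus>\<^bsub>E\<^esub> f = f"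
    by (rule hom_eqI) (use f in \<open>simp_all add: End_simps End_closed\<close>, simp add: zero_hom_def D)
  show "\<exists>h\<in>carrier E. h \<oplus>\<^bsub>E\<^esub> f = \<zero>\<^bsub>E\<^esub>"
  proof
    show "(\<lambda>x\<in>carrier M. \<ominus>\<^bsub>M\<^esub> f x) \<in> carrier E"
      using End_minus_closed f by (simp add: End_simps)
    show "(\<lambda>x\<in>carrier M. \<ominus>\<^bsub>M\<^esub> f x) \<oplus>\<^bsub>E\<^esub> f = \<zero>\<^bsub>E\<^esub>"
      by (auto simp: End_simps zero_hom_def M.l_neg D intro: restrict_ext)
  qed
  fix h assume "h \<in> carrier E"
  then have h: "h \<in> module_hom L M M" by (simp add: End_simps)
  show "f \<oplus>\<^bsub>E\<^esub> g \<oplus>\<^bsub>E\<^esub> h = f \<oplus>\<^bsub>E\<^esub> (g \<oplus>\<^bsub>E\<^esub> h)"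
    by (auto simp: End_simps D module_homD(2)[OF h] M.a_assoc intro: restrict_ext)
qed

lemma ring_End: "ring E"
proof (rule ringI)
  show "abelian_group E" by (rule abelian_group_End)
  show "Group.monoid E"
  proof (rule monoidI)
    show "\<one>\<^bsub>E\<^esub> \<in> carrier E"
      by (simp add: End_simps End_closed)
  next
    fix f g assume "f \<in> carrier E" "g \<in> carrier E"
    then have f: "f \<in> module_hom L M M" and g: "g \<in> module_hom L M M"
      by (simp_all add: End_simps)
    show "f \<otimes>\<^bsub>E\<^esub> g \<in> carrier E"
      using f g by (simp add: End_simps End_closed)
    show "\<one>\<^bsub>E\<^esub> \<otimes>\<^bsub>E\<^esub> f = f" "f \<otimes>\<^bsub>E\<^esub> \<one>\<^bsub>E\<^esub> = f"
      using f by (auto intro!: hom_eqI simp: End_simps End_closed compose_eq module_homD(2)[OF f])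
    fix h assume "h \<in> carrier E"
    then have h: "h \<in> module_hom L M M" by (simp add: End_simps)
    show "f \<otimes>\<^bsub>E\<^esub> g \<otimes>\<^bsub>E\<^esub> h = f \<otimes>\<^bsub>E\<^esub> (g \<otimes>\<^bsub>E\<^esub> h)"
      by (auto simp: End_simps compose_def module_homD(2)[OF h] intro: restrict_ext)
  qed
next
  fix f g h assume "f \<in> carrier E" "g \<in> carrier E" "h \<in> carrier E"
  then have f: "f \<in> module_hom L M M" and g: "g \<in> module_hom L M M"
    and h: "h \<in> module_hom L M M"
    by (simp_all add: End_simps)
  note D = module_homD(2)[OF f] module_homD(2)[OF g] module_homD(2,3)[OF h]
  show "(f \<oplus>\<^bsub>E\<^esub> g) \<otimes>\<^bsub>E\<^esub> h = f \<otimes>\<^bsub>E\<^esub> h \<oplus>\<^bsub>E\<^esub> g \<otimes>\<^bsub>E\<^esub> h"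
    "h \<otimes>\<^bsub>E\<^esub> (f \<oplus>\<^bsub>E\<^esub> g) = h \<otimes>\<^bsub>E\<^esub> f \<oplus>\<^bsub>E\<^esub> h \<otimes>\<^bsub>E\<^esub> g"
    by (auto simp: End_simps compose_def D intro: restrict_ext)
qed

text \<open>Holds for every \<open>L\<close>-module, so the only real content of
  \<open>division_algebra\<close> for \<open>E\<close> is in its conditions on one, zero and the
  units.\<close>

lemma assoc_algebra_End: "assoc_algebra K E"
proof -
  have "module K E"
  proof (rule moduleI)
    show "cring K" by (rule L.is_cring)
    show "abelian_group E" by (rule abelian_group_End)
  next
    fix f assume "f \<in> carrier E"
    then have f: "f \<in> module_hom L M M" by (simp add: End_simps)
    note D = module_homD(2)[OF f]
    show "\<one>\<^bsub>K\<^esub> \<odot>\<^bsub>E\<^esub> f = f"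
      using f by (auto intro!: hom_eqI simp: End_simps End_closed scal_one D)
    fix c d g assume c: "c \<in> carrier K"
    show "c \<odot>\<^bsub>E\<^esub> f \<in> carrier E"
      using c f by (simp add: End_simps End_closed)
    show "(c \<oplus>\<^bsub>K\<^esub> d) \<odot>\<^bsub>E\<^esub> f = c \<odot>\<^bsub>E\<^esub> f \<oplus>\<^bsub>E\<^esub> d \<odot>\<^bsub>E\<^esub> f"
      "(c \<otimes>\<^bsub>K\<^esub> d) \<odot>\<^bsub>E\<^esub> f = c \<odot>\<^bsub>E\<^esub> (d \<odot>\<^bsub>E\<^esub> f)" if "d \<in> carrier K"
      using c that by (auto simp: End_simps scal_closed scal_l_distr scal_mult D intro: restrict_ext)
    assume "g \<in> carrier E"
    then have "g \<in> module_hom L M M" by (simp add: End_simps)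
    note D = D module_homD(2)[OF this]
    show "c \<odot>\<^bsub>E\<^esub> (f \<oplus>\<^bsub>E\<^esub> g) = c \<odot>\<^bsub>E\<^esub> f \<oplus>\<^bsub>E\<^esub> c \<odot>\<^bsub>E\<^esub> g"
      using c by (auto simp: End_simps scal_r_distr D intro: restrict_ext)
  qed
  moreover have "(c \<odot>\<^bsub>E\<^esub> f) \<otimes>\<^bsub>E\<^esub> g = c \<odot>\<^bsub>E\<^esub> (f \<otimes>\<^bsub>E\<^esub> g)"
    "f \<otimes>\<^bsub>E\<^esub> (c \<odot>\<^bsub>E\<^esub> g) = c \<odot>\<^bsub>E\<^esub> (f \<otimes>\<^bsub>E\<^esub> g)"
    if c: "c \<in> carrier K" and fg: "f \<in> carrier E" "g \<in> carrier E" for c f g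
  proof -
    have f: "f \<in> module_hom L M M" and g: "g \<in> module_hom L M M"
      using fg by (simp_all add: End_simps)
    show "(c \<odot>\<^bsub>E\<^esub> f) \<otimes>\<^bsub>E\<^esub> g = c \<odot>\<^bsub>E\<^esub> (f \<otimes>\<^bsub>E\<^esub> g)"
      "f \<otimes>\<^bsub>E\<^esub> (c \<odot>\<^bsub>E\<^esub> g) = c \<odot>\<^bsub>E\<^esub> (f \<otimes>\<^bsub>E\<^esub> g)"
      using c by (auto simp: End_simps compose_def module_homD(2)[OF g] hom_scal[OF f]
          intro: restrict_ext)
  qed
  ultimately show ?thesis
    by (intro assoc_algebra.intro assoc_algebra_axioms.intro L.field_axioms ring_End)
qed

text \<open>The set-theoretic inverse of a bijective endomorphism is automatically linear.\<close>

lemma End_Units_iff: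
  "f \<in> Units E \<longleftrightarrow> f \<in> module_hom L M M \<and> bij_betw f (carrier M) (carrier M)"
proof
  assume "f \<in> Units E"
  then obtain g where f: "f \<in> module_hom L M M" and g: "g \<in> module_hom L M M"
    and fg: "compose (carrier M) f g = (\<lambda>x\<in>carrier M. x)"
    and gf: "compose (carrier M) g f = (\<lambda>x\<in>carrier M. x)"
    by (auto simp: Units_def End_simps)
  have "bij_betw f (carrier M) (carrier M)"
  proof (rule bij_betwI[where g = g])
    fix x assume "x \<in> carrier M"
    then show "g (f x) = x" "f (g x) = x"
      using fun_cong[OF gf, of x] fun_cong[OF fg, of x] by (auto simp: compose_def)
  qed (use module_homD[OF f] module_homD[OF g] in auto)
  with f show "f \<in> module_hom L M M \<and> bij_betw f (carrier M) (carrier M)" ..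
next
  assume "f \<in> module_hom L M M \<and> bij_betw f (carrier M) (carrier M)"
  then have f: "f \<in> module_hom L M M" and bij: "bij_betw f (carrier M) (carrier M)"
    by auto
  let ?g = "\<lambda>x\<in>carrier M. inv_into (carrier M) f x"
  have g: "?g \<in> module_hom L M M"
    using f bij left_module_axioms left_module_axioms by (rule inv_into_in_module_hom)
  have "?g \<otimes>\<^bsub>E\<^esub> f = \<one>\<^bsub>E\<^esub>" "f \<otimes>\<^bsub>E\<^esub> ?g = \<one>\<^bsub>E\<^esub>"
    using bij by (simp_all add: End_simps compose_inv_into_id compose_id_inv_into bij_betw_def)
  with f g show "f \<in> Units E"
    by (auto simp: Units_def End_simps)
qed

lemma division_algebra_End_iff: "division_algebra K E \<longleftrightarrow> brick L M"
proof -
  have one: "\<one>\<^bsub>E\<^esub> \<noteq> \<zero>\<^bsub>E\<^esub> \<longleftrightarrow> (\<exists>x\<in>carrier M. x \<noteq> \<zero>\<^bsub>M\<^esub>)"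
  proof -
    have "\<one>\<^bsub>E\<^esub> = \<zero>\<^bsub>E\<^esub> \<longleftrightarrow> (\<forall>x\<in>carrier M. x = \<zero>\<^bsub>M\<^esub>)"
      unfolding End_simps zero_hom_def
      by (metis restrict_apply' restrict_ext)
    then show ?thesis by blast
  qed
  have zero: "\<not> bij_betw (zero_hom M M) (carrier M) (carrier M)"
    if "x \<in> carrier M" "x \<noteq> \<zero>\<^bsub>M\<^esub>" for x
  proof
    assume "bij_betw (zero_hom M M) (carrier M) (carrier M)"
    then have "inj_on (zero_hom M M) (carrier M)" by (simp add: bij_betw_def)
    from inj_onD[OF this, of x "\<zero>\<^bsub>M\<^esub>"] that show False by (simp add: zero_hom_def)
  qed
  have units: "Units E = carrier E - {\<zero>\<^bsub>E\<^esub>} \<longleftrightarrow>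
      (\<forall>h\<in>module_hom L M M. h \<noteq> zero_hom M M \<longrightarrow> bij_betw h (carrier M) (carrier M))"
    if "\<exists>x\<in>carrier M. x \<noteq> \<zero>\<^bsub>M\<^esub>"
  proof -
    \<comment> \<open>On a nonzero module the zero map is not injective, so units are nonzero; the
      reverse inclusion is exactly the second clause of \<open>brick\<close>.\<close>
    have "\<not> bij_betw (zero_hom M M) (carrier M) (carrier M)"
      using zero that by blast
    then have "h \<noteq> zero_hom M M" if "bij_betw h (carrier M) (carrier M)" for h
      using that by blast
    then show ?thesis
      unfolding set_eq_iff End_Units_iff Diff_iff singleton_iff End_simps(1,4) by blast
  qed
  have "division_algebra K E \<longleftrightarrow> \<one>\<^bsub>E\<^esub> \<noteq> \<zero>\<^bsub>E\<^esub> \<and> Units E = carrier E - {\<zero>\<^bsub>E\<^esub>}"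
    unfolding division_algebra_def by (rule iffI, erule conjunct2, rule conjI, rule assoc_algebra_End)
  also have "\<dots> \<longleftrightarrow> brick L M"
    unfolding brick_def by (rule conj_cong[OF one units])
  finally show ?thesis .
qed

end


section \<open>Transport along semilinear bijections\<close>

text \<open>
  The map \<open>\<sigma>\<close> is an arbitrary function because the main instance, \<open>a \<mapsto> (a, 0, 0)\<close>, does not
  preserve the unit.
\<close>

definition semilinear_bij ::
  "('a \<Rightarrow> 'b) \<Rightarrow> ('m \<Rightarrow> 'n) \<Rightarrow> ('a, 'r) ring_scheme \<Rightarrow> ('a, 'm, 's) module_scheme \<Rightarrow>
   ('b, 'q) ring_scheme \<Rightarrow> ('b, 'n, 't) module_scheme \<Rightarrow> bool" where
  "semilinear_bij \<sigma> \<phi> R M R' M' \<longleftrightarrow>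
     left_module R M \<and> left_module R' M' \<and>
     \<sigma> \<in> carrier R \<rightarrow> carrier R' \<and> bij_betw \<phi> (carrier M) (carrier M') \<and>
     (\<forall>x\<in>carrier M. \<forall>y\<in>carrier M. \<phi> (x \<oplus>\<^bsub>M\<^esub> y) = \<phi> x \<oplus>\<^bsub>M'\<^esub> \<phi> y) \<and>
     (\<forall>a\<in>carrier R. \<forall>x\<in>carrier M. \<phi> (a \<odot>\<^bsub>M\<^esub> x) = \<sigma> a \<odot>\<^bsub>M'\<^esub> \<phi> x)"

lemma semilinear_bijD:
  assumes "semilinear_bij \<sigma> \<phi> R M R' M'"
  shows "left_module R M" "left_module R' M'"
    and "bij_betw \<phi> (carrier M) (carrier M')"
    and "a \<in> carrier R \<Longrightarrow> \<sigma> a \<in> carrier R'"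
    and "x \<in> carrier M \<Longrightarrow> \<phi> x \<in> carrier M'"
    and "x \<in> carrier M \<Longrightarrow> y \<in> carrier M \<Longrightarrow> \<phi> (x \<oplus>\<^bsub>M\<^esub> y) = \<phi> x \<oplus>\<^bsub>M'\<^esub> \<phi> y"
    and "a \<in> carrier R \<Longrightarrow> x \<in> carrier M \<Longrightarrow> \<phi> (a \<odot>\<^bsub>M\<^esub> x) = \<sigma> a \<odot>\<^bsub>M'\<^esub> \<phi> x"
  using assms by (auto simp: semilinear_bij_def bij_betw_def)

lemma semilinear_bij_zero:
  assumes "semilinear_bij \<sigma> \<phi> R M R' M'"
  shows "\<phi> \<zero>\<^bsub>M\<^esub> = \<zero>\<^bsub>M'\<^esub>"
proof -
  interpret M: left_module R M using assms by (rule semilinear_bijD)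
  interpret M': left_module R' M' using assms by (rule semilinear_bijD)
  show ?thesis
    using M.M.abelian_group_axioms M'.M.abelian_group_axioms
    by (rule additive_zero) (auto simp: semilinear_bijD[OF assms])
qed

lemma semilinear_bij_surj:
  assumes "semilinear_bij \<sigma> \<phi> R M R' M'" "y \<in> carrier M'"
  obtains x where "x \<in> carrier M" "y = \<phi> x"
  using semilinear_bijD(3)[OF assms(1)] assms(2) by (auto simp: bij_betw_def)

text \<open>This moves the target from a standard model to any other member of its isomorphism
  class.\<close>

lemma semilinear_bij_module_iso:
  assumes \<phi>: "semilinear_bij \<sigma> \<phi> R M R' M'" and iso: "module_iso R' M' N" "left_module R' N"
  obtains \<psi> where "semilinear_bij \<sigma> \<psi> R M R' N"
proof -
  obtain h where h: "h \<in> module_hom R' M' N" "bij_betw h (carrier M') (carrier N)"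
    using iso by (auto simp: module_iso_def)
  have "bij_betw (h \<circ> \<phi>) (carrier M) (carrier N)"
    using semilinear_bijD(3)[OF \<phi>] h(2) by (rule bij_betw_trans)
  then have "semilinear_bij \<sigma> (h \<circ> \<phi>) R M R' N"
    using semilinear_bijD[OF \<phi>] iso(2) module_homD[OF h(1)] by (auto simp: semilinear_bij_def)
  then show ?thesis ..
qed

text \<open>Take \<open>g\<close> to be \<open>\<psi>\<close> inverse after \<open>h\<close> after
  \<open>\<phi>\<close>. It is \<open>R\<close>-linear because \<open>h\<close> commutes in
  particular with the elements \<open>\<sigma> a\<close>. Both laws for \<open>g\<close> are checked
  after applying the injective \<open>\<psi>\<close>.\<close>

lemma semilinear_bij_pullback_hom:
  assumes \<phi>: "semilinear_bij \<sigma> \<phi> R M R' M'" and \<psi>: "semilinear_bij \<sigma> \<psi> R N R' N'"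
    and h: "h \<in> module_hom R' M' N'"
  shows "\<exists>g\<in>module_hom R M N. \<forall>x\<in>carrier M. \<psi> (g x) = h (\<phi> x)"
proof -
  interpret M: left_module R M using \<phi> by (rule semilinear_bijD)
  interpret N: left_module R N using \<psi> by (rule semilinear_bijD)
  define g where "g = (\<lambda>x\<in>carrier M. inv_into (carrier N) \<psi> (h (\<phi> x)))"
  have h\<phi>: "h (\<phi> x) \<in> carrier N'" if "x \<in> carrier M" for x
    using that semilinear_bijD[OF \<phi>] module_homD[OF h] by auto
  have g: "g x \<in> carrier N" "\<psi> (g x) = h (\<phi> x)" if "x \<in> carrier M" for x
    using that h\<phi>[OF that] semilinear_bijD(3)[OF \<psi>]
    by (auto simp: g_def bij_betw_def inv_into_into f_inv_into_f)
  have eq: "g x = y" if "x \<in> carrier M" "y \<in> carrier N" "h (\<phi> x) = \<psi> y" for x y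
    using that semilinear_bijD(3)[OF \<psi>] by (auto simp: g_def bij_betw_def inv_into_f_f)
  have "g \<in> module_hom R M N"
  proof (rule module_homI)
    show "g \<in> carrier M \<rightarrow>\<^sub>E carrier N"
      using g by (auto simp: g_def)
  next
    fix x y assume "x \<in> carrier M" "y \<in> carrier M"
    then show "g (x \<oplus>\<^bsub>M\<^esub> y) = g x \<oplus>\<^bsub>N\<^esub> g y"
      by (intro eq) (auto simp: g semilinear_bijD[OF \<phi>] semilinear_bijD[OF \<psi>] module_homD[OF h])
  next
    fix a x assume "a \<in> carrier R" "x \<in> carrier M"
    then show "g (a \<odot>\<^bsub>M\<^esub> x) = a \<odot>\<^bsub>N\<^esub> g x"
      by (intro eq) (auto simp: g semilinear_bijD[OF \<phi>] semilinear_bijD[OF \<psi>] module_homD[OF h]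
          M.smult_closed N.smult_closed)
  qed
  with g(2) show ?thesis by blast
qed

lemma pullback_hom_zero:
  assumes \<phi>: "semilinear_bij \<sigma> \<phi> R M R' M'" and \<psi>: "semilinear_bij \<sigma> \<psi> R N R' N'"
    and "\<And>x. x \<in> carrier M \<Longrightarrow> \<psi> (zero_hom M N x) = h (\<phi> x)" and y: "y \<in> carrier M'"
  shows "h y = \<zero>\<^bsub>N'\<^esub>"
  using semilinear_bij_surj[OF \<phi> y] assms(3) semilinear_bij_zero[OF \<psi>]
  by (metis zero_hom_def restrict_apply')

lemma semilinear_bij_hom_zero:
  assumes \<phi>: "semilinear_bij \<sigma> \<phi> R M R' M'" and \<psi>: "semilinear_bij \<sigma> \<psi> R N R' N'"
    and zero: "module_hom R M N = {zero_hom M N}"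
  shows "module_hom R' M' N' = {zero_hom M' N'}"
proof (rule module_hom_eq_zeroI)
  fix h y assume h: "h \<in> module_hom R' M' N'" and y: "y \<in> carrier M'"
  obtain g where "g \<in> module_hom R M N" "\<And>x. x \<in> carrier M \<Longrightarrow> \<psi> (g x) = h (\<phi> x)"
    using semilinear_bij_pullback_hom[OF \<phi> \<psi> h] by blast
  with zero show "h y = \<zero>\<^bsub>N'\<^esub>"
    by (intro pullback_hom_zero[OF \<phi> \<psi> _ y]) auto
qed (use semilinear_bijD(2)[OF \<phi>] semilinear_bijD(2)[OF \<psi>] in auto)

lemma semilinear_bij_brick:
  assumes \<phi>: "semilinear_bij \<sigma> \<phi> R M R' M'" and brick: "brick R M"
  shows "brick R' M'"
proof -
  interpret M: left_module R M using \<phi> by (rule semilinear_bijD)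
  have bij: "bij_betw \<phi> (carrier M) (carrier M')"
    using \<phi> by (rule semilinear_bijD)
  obtain x where x: "x \<in> carrier M" "x \<noteq> \<zero>\<^bsub>M\<^esub>"
    using brick by (auto simp: brick_def)
  then have "\<phi> x \<noteq> \<phi> \<zero>\<^bsub>M\<^esub>"
    using bij by (auto simp: bij_betw_def dest: inj_onD)
  with x have "\<exists>y\<in>carrier M'. y \<noteq> \<zero>\<^bsub>M'\<^esub>"
    using semilinear_bijD(5)[OF \<phi>] semilinear_bij_zero[OF \<phi>] by force
  moreover have "bij_betw h (carrier M') (carrier M')"
    if h: "h \<in> module_hom R' M' M'" and "h \<noteq> zero_hom M' M'" for h
  proof -
    obtain g where g: "g \<in> module_hom R M M" "\<And>x. x \<in> carrier M \<Longrightarrow> \<phi> (g x) = h (\<phi> x)"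
      using semilinear_bij_pullback_hom[OF \<phi> \<phi> h] by blast
    have "g \<noteq> zero_hom M M"
    proof
      assume "g = zero_hom M M"
      then have "h y = \<zero>\<^bsub>M'\<^esub>" if "y \<in> carrier M'" for y
        using g(2) that by (intro pullback_hom_zero[OF \<phi> \<phi>]) auto
      then have "h = zero_hom M' M'"
        by (intro extensionalityI[of _ "carrier M'"]) (auto simp: zero_hom_def module_homD(1)[OF h])
      with \<open>h \<noteq> zero_hom M' M'\<close> show False ..
    qed
    with g(1) brick have "bij_betw g (carrier M) (carrier M)"
      by (auto simp: brick_def)
    then have "bij_betw (\<phi> \<circ> g) (carrier M) (carrier M')"
      using bij by (rule bij_betw_trans)
    then have "bij_betw (h \<circ> \<phi>) (carrier M) (carrier M')"
      using g(2) by (simp cong: bij_betw_cong)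
    \<comment> \<open>Since \<open>h \<circ> \<phi> = \<phi> \<circ> g\<close> on the carrier and
      \<open>\<phi>\<close> is bijective, \<open>\<phi>\<close> can be cancelled on the
      right.\<close>
    then show ?thesis
      using bij_betw_comp_iff[OF bij] by blast
  qed
  ultimately show ?thesis by (auto simp: brick_def)
qed

lemma semilinear_bij_finsum:
  assumes \<phi>: "semilinear_bij \<sigma> \<phi> R M R' M'" and "finite S" "f \<in> S \<rightarrow> carrier M"
  shows "\<phi> (\<Oplus>\<^bsub>M\<^esub>s\<in>S. f s) = (\<Oplus>\<^bsub>M'\<^esub>s\<in>S. \<phi> (f s))"
proof -
  interpret M: left_module R M using \<phi> by (rule semilinear_bijD)
  interpret M': left_module R' M' using \<phi> by (rule semilinear_bijD)
  show ?thesis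
    using assms(2,3)
  proof (induction S)
    case empty
    then show ?case using semilinear_bij_zero[OF \<phi>] by simp
  next
    case (insert s S)
    then have "f \<in> S \<rightarrow> carrier M" "f s \<in> carrier M" "(\<lambda>s. \<phi> (f s)) \<in> S \<rightarrow> carrier M'"
      using semilinear_bijD(5)[OF \<phi>] by auto
    with insert show ?case
      by (simp add: semilinear_bijD[OF \<phi>] M.M.finsum_closed)
  qed
qed

text \<open>The image of a generating set generates: \<open>\<phi>\<close> turns an
  \<open>R\<close>-combination into an \<open>R'\<close>-combination whose coefficients lie in the
  image of \<open>\<sigma>\<close>.\<close>

lemma semilinear_bij_fin_gen:
  assumes \<phi>: "semilinear_bij \<sigma> \<phi> R M R' M'" and "fin_gen R M"
  shows "fin_gen R' M'"
proof -
  interpret M: left_module R M using \<phi> by (rule semilinear_bijD)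
  interpret M': left_module R' M' using \<phi> by (rule semilinear_bijD)
  obtain S where S: "finite S" "S \<subseteq> carrier M"
    and gen: "\<And>m. m \<in> carrier M \<Longrightarrow> \<exists>c\<in>S \<rightarrow> carrier R. m = (\<Oplus>\<^bsub>M\<^esub>s\<in>S. c s \<odot>\<^bsub>M\<^esub> s)"
    using assms(2) by (auto simp: fin_gen_def)
  have inj: "inj_on \<phi> S"
    using semilinear_bijD(3)[OF \<phi>] S(2) by (auto simp: bij_betw_def intro: inj_on_subset)
  have "\<exists>d\<in>\<phi> ` S \<rightarrow> carrier R'. y = (\<Oplus>\<^bsub>M'\<^esub>t\<in>\<phi> ` S. d t \<odot>\<^bsub>M'\<^esub> t)" if y: "y \<in> carrier M'" for y
  proof -
    obtain x where x: "x \<in> carrier M" "y = \<phi> x"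
      using \<phi> y by (rule semilinear_bij_surj)
    obtain c where c: "c \<in> S \<rightarrow> carrier R" "x = (\<Oplus>\<^bsub>M\<^esub>s\<in>S. c s \<odot>\<^bsub>M\<^esub> s)"
      using gen[OF x(1)] by blast
    \<comment> \<open>Coefficients are indexed by the generators themselves, so they are relabelled
      along \<open>\<phi>\<close>, which is injective on \<open>S\<close>.\<close>
    let ?d = "\<lambda>t. \<sigma> (c (inv_into S \<phi> t))"
    have mem: "s \<in> carrier M" "c s \<in> carrier R" "\<phi> s \<in> carrier M'" "\<sigma> (c s) \<in> carrier R'"
      if "s \<in> S" for s
      using that S(2) c(1) semilinear_bijD[OF \<phi>] by auto
    have "y = (\<Oplus>\<^bsub>M'\<^esub>s\<in>S. \<phi> (c s \<odot>\<^bsub>M\<^esub> s))"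
      unfolding x(2) c(2) using S(1) by (rule semilinear_bij_finsum[OF \<phi>]) (auto simp: mem M.smult_closed)
    also have "\<dots> = (\<Oplus>\<^bsub>M'\<^esub>s\<in>S. ?d (\<phi> s) \<odot>\<^bsub>M'\<^esub> \<phi> s)"
      by (rule M'.M.finsum_cong')
        (auto simp: mem inj M'.smult_closed inv_into_f_f semilinear_bijD(7)[OF \<phi>])
    also have "\<dots> = (\<Oplus>\<^bsub>M'\<^esub>t\<in>\<phi> ` S. ?d t \<odot>\<^bsub>M'\<^esub> t)"
      by (rule M'.M.finsum_reindex[symmetric])
        (auto simp: mem inj M'.smult_closed inv_into_f_f)
    finally show ?thesis
      by (intro bexI[of _ ?d]) (auto simp: mem inj inv_into_f_f)
  qed
  moreover have "finite (\<phi> ` S)" "\<phi> ` S \<subseteq> carrier M'"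
    using S semilinear_bijD(5)[OF \<phi>] by auto
  ultimately show ?thesis
    unfolding fin_gen_def by blast
qed

text \<open>The unit of \<open>R\<close> acts as the identity on \<open>M\<close>, and
  \<open>\<phi>\<close> transports this action to that of \<open>\<sigma> \<one>\<close>, whether or
  not \<open>\<sigma> \<one>\<close> is the unit of \<open>R'\<close>. For the two corner embeddings
  these elements are the two diagonal idempotents.\<close>

lemma semilinear_bij_one_acts_as_id:
  assumes \<phi>: "semilinear_bij \<sigma> \<phi> R M R' M'" and y: "y \<in> carrier M'"
  shows "\<sigma> \<one>\<^bsub>R\<^esub> \<odot>\<^bsub>M'\<^esub> y = y"
proof -
  interpret M: left_module R M using \<phi> by (rule semilinear_bijD)
  obtain x where x: "x \<in> carrier M" "y = \<phi> x"
    using \<phi> y by (rule semilinear_bij_surj)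
  show ?thesis
    using semilinear_bijD(7)[OF \<phi> M.one_closed x(1)] M.smult_one[OF x(1)] x(2) by simp
qed


section \<open>The one-point extension and its modules\<close>

lemma principal_left_module_simps:
  "\<zero>\<^bsub>principal_left_module R e\<^esub> = \<zero>\<^bsub>R\<^esub>"
  "x \<oplus>\<^bsub>principal_left_module R e\<^esub> y = x \<oplus>\<^bsub>R\<^esub> y"
  "a \<odot>\<^bsub>principal_left_module R e\<^esub> x = a \<otimes>\<^bsub>R\<^esub> x"
  by (simp_all add: principal_left_module_def)

context ring
begin

text \<open>The principal module at the idempotent \<open>\<one>\<close> serves as the ring regarded
  as a left module over itself; over \<open>K\<close> it is the source of the bijection onto
  \<open>S_a\<close>.\<close>

lemma carrier_self: "carrier (principal_left_module R \<one>) = carrier R"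
proof -
  have "\<exists>a. x = a \<otimes> \<one> \<and> a \<in> carrier R" if "x \<in> carrier R" for x
    using that by (intro exI[of _ x]) simp
  then show ?thesis by (auto simp: principal_left_module_def)
qed

lemma left_module_self: "left_module R (principal_left_module R \<one>)"
proof -
  have "abelian_group (principal_left_module R \<one>)"
    by (rule abelian_groupI, unfold carrier_self principal_left_module_simps) (auto simp: a_ac intro: l_neg)
  then show ?thesis
    by (intro left_module.intro left_module_axioms.intro ring_axioms; (unfold carrier_self principal_left_module_simps)?)
      (auto simp: l_distr r_distr m_assoc)
qed

lemma fin_gen_self: "fin_gen R (principal_left_module R \<one>)"
proof -
  interpret P: left_module R "principal_left_module R \<one>" by (rule left_module_self)
  have "m = (\<Oplus>\<^bsub>principal_left_module R \<one>\<^esub>s\<in>{\<one>}. m \<odot>\<^bsub>principal_left_module R \<one>\<^esub> s)"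
    if "m \<in> carrier R" for m
    using that by (subst P.M.finsum_insert) (auto simp: carrier_self principal_left_module_simps)
  then have "\<exists>c\<in>{\<one>} \<rightarrow> carrier R. m = (\<Oplus>\<^bsub>principal_left_module R \<one>\<^esub>s\<in>{\<one>}.
      c s \<odot>\<^bsub>principal_left_module R \<one>\<^esub> s)" if "m \<in> carrier R" for m
    using that by (intro bexI[of _ "\<lambda>_. m"]) auto
  then show ?thesis
    unfolding fin_gen_def carrier_self by (intro exI[of _ "{\<one>}"]) simp
qed

end

text \<open>An endomorphism of the regular module is right multiplication by
  \<open>u = h \<one>\<close>; over a field a nonzero \<open>u\<close> is invertible.\<close>

lemma (in field) brick_self: "brick R (principal_left_module R \<one>)"
proof -
  let ?P = "principal_left_module R \<one>"
  have "bij_betw h (carrier R) (carrier R)"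
    if h: "h \<in> module_hom R ?P ?P" and nz: "h \<noteq> zero_hom ?P ?P" for h
  proof -
    obtain u where u: "u \<in> carrier R" and hx: "\<And>x. x \<in> carrier R \<Longrightarrow> h x = x \<otimes> u"
    proof
      show "h \<one> \<in> carrier R"
        using module_homD(2)[OF h] by (simp add: carrier_self)
      show "h x = x \<otimes> h \<one>" if "x \<in> carrier R" for x
        using module_homD(4)[OF h that, of \<one>] that by (simp add: carrier_self principal_left_module_simps)
    qed
    have "u \<noteq> \<zero>"
    proof
      assume "u = \<zero>"
      then have "h x = zero_hom ?P ?P x" if "x \<in> carrier R" for x
        using hx that by (simp add: zero_hom_def carrier_self principal_left_module_simps)
      then have "h = zero_hom ?P ?P"
        using module_homD(1)[OF h]
        by (intro extensionalityI[of _ "carrier R"]) (auto simp: zero_hom_def carrier_self)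
      with nz show False ..
    qed
    then have "u \<in> Units R" using u by (simp add: field_Units)
    then show ?thesis
      by (intro bij_betwI[where g = "\<lambda>y. y \<otimes> inv u"]) (use u in \<open>auto simp: hx m_assoc\<close>)
  qed
  then show ?thesis
    unfolding brick_def carrier_self principal_left_module_simps by (auto intro!: bexI[of _ \<one>])
qed

section \<open>The algebra structure of the one-point extension\<close>

locale extension_data = A: assoc_algebra K A + V: left_module A V
  for K :: "'k ring" and A :: "('k, 'a) module" and V :: "('a, 'x) module"
begin

sublocale V: algebra_module K A V ..

abbreviation (input) B where "B \<equiv> one_point_extension K A V"

lemma B_simps:
  "carrier B = carrier A \<times> carrier V \<times> carrier K"
  "(a, x, c) \<otimes>\<^bsub>B\<^esub> (a', x', c') =
    (a \<otimes>\<^bsub>A\<^esub> a', a \<odot>\<^bsub>V\<^esub> x' \<oplus>\<^bsub>V\<^esub> V.scal c' x, c \<otimes>\<^bsub>K\<^esub> c')"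
  "\<one>\<^bsub>B\<^esub> = (\<one>\<^bsub>A\<^esub>, \<zero>\<^bsub>V\<^esub>, \<one>\<^bsub>K\<^esub>)"
  "\<zero>\<^bsub>B\<^esub> = (\<zero>\<^bsub>A\<^esub>, \<zero>\<^bsub>V\<^esub>, \<zero>\<^bsub>K\<^esub>)"
  "(a, x, c) \<oplus>\<^bsub>B\<^esub> (a', x', c') = (a \<oplus>\<^bsub>A\<^esub> a', x \<oplus>\<^bsub>V\<^esub> x', c \<oplus>\<^bsub>K\<^esub> c')"
  "d \<odot>\<^bsub>B\<^esub> (a, x, c) = (d \<odot>\<^bsub>A\<^esub> a, V.scal d x, d \<otimes>\<^bsub>K\<^esub> c)"
  by (simp_all add: one_point_extension_def V.scal_def)

lemmas V_simps = V.scal_closed V.scal_r_distr V.scal_l_distr V.scal_mult V.scal_one V.scal_zero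
  V.smult_scal V.smult_closed V.smult_l_distr V.smult_r_distr V.smult_assoc1 V.smult_one
  V.smult_r_null V.smult_l_null

lemma scal_r_null: "c \<in> carrier K \<Longrightarrow> V.scal c \<zero>\<^bsub>V\<^esub> = \<zero>\<^bsub>V\<^esub>"
  by (simp add: V.scal_def V.smult_r_null)

lemma scal_commute:
  assumes "c \<in> carrier K" "d \<in> carrier K" "x \<in> carrier V"
  shows "V.scal c (V.scal d x) = V.scal d (V.scal c x)"
  using assms by (simp add: V.scal_mult[symmetric] A.m_comm)

lemma abelian_group_B: "abelian_group B"
proof (rule abelian_groupI)
  fix b assume "b \<in> carrier B"
  then obtain a x c where "b = (a, x, c)" "a \<in> carrier A" "x \<in> carrier V" "c \<in> carrier K"
    by (auto simp: B_simps)
  then show "\<exists>b'\<in>carrier B. b' \<oplus>\<^bsub>B\<^esub> b = \<zero>\<^bsub>B\<^esub>"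
    by (intro bexI[of _ "(\<ominus>\<^bsub>A\<^esub> a, \<ominus>\<^bsub>V\<^esub> x, \<ominus>\<^bsub>K\<^esub> c)"])
      (auto simp: B_simps A.M.l_neg V.M.l_neg A.R.l_neg)
qed (auto simp: B_simps A.M.a_ac V.M.a_ac A.R.a_ac)

text \<open>In the upper right entry, associativity is the bimodule property of \<open>V\<close>:
  the actions of \<open>A\<close> and \<open>K\<close> commute, and the order of two scalars does
  not matter.\<close>

lemma ring_B: "ring B"
proof (rule ringI)
  show "abelian_group B" by (rule abelian_group_B)
  show "Group.monoid B"
    by (rule monoidI) (auto simp: B_simps V_simps scal_r_null scal_commute A.m_comm A.R.m_assoc A.R.m_lcomm A.m_assoc V.M.a_ac)
qed (auto simp: B_simps V_simps A.l_distr A.r_distr A.R.l_distr A.R.r_distr V.M.a_ac)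

lemma assoc_algebra_B: "assoc_algebra K B"
proof -
  have "module K B"
  proof (rule moduleI)
    show "cring K" by (rule A.is_cring)
    show "abelian_group B" by (rule abelian_group_B)
  qed (auto simp: B_simps V_simps A.smult_l_distr A.smult_r_distr A.smult_assoc1 A.R.l_distr
      A.R.r_distr A.m_comm A.R.m_assoc A.R.m_lcomm)
  then show ?thesis
    by (intro assoc_algebra.intro assoc_algebra_axioms.intro A.field_axioms ring_B)
      (auto simp: B_simps V_simps scal_commute A.smult_mult_left A.smult_mult_right A.m_comm A.R.m_assoc A.R.m_lcomm)
qed

section \<open>Modules over \<open>A\<close> as modules over the extension\<close>

abbreviation ext :: "('a, 'm) module \<Rightarrow> ('a \<times> 'x \<times> 'k, 'm \<times> (nat \<Rightarrow> 'k)) module" where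
  "ext M \<equiv> extend_by_zero K M"

text \<open>For \<open>n = 0\<close> the extensional function space has the single element
  \<open>\<lambda>_. undefined\<close>. The summand \<open>\<zero>\<close> in the action is the
  value of the zero structure map; it stays because \<open>M\<close> is still an arbitrary record
  here.\<close>

lemma extend_simps:
  "carrier (ext M) = carrier M \<times> {\<lambda>_. undefined}"
  "\<zero>\<^bsub>ext M\<^esub> = (\<zero>\<^bsub>M\<^esub>, \<lambda>_. undefined)"
  "(m, v) \<oplus>\<^bsub>ext M\<^esub> (m', v') = (m \<oplus>\<^bsub>M\<^esub> m', \<lambda>_. undefined)"
  "(a, x, c) \<odot>\<^bsub>ext M\<^esub> (m, v) = (a \<odot>\<^bsub>M\<^esub> m \<oplus>\<^bsub>M\<^esub> \<zero>\<^bsub>M\<^esub>, \<lambda>_. undefined)"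
  by (simp_all add: extend_by_zero_def triple_module_def restrict_def)

lemma left_module_extend:
  assumes "left_module A M"
  shows "left_module B (ext M)"
proof -
  interpret M: left_module A M by fact
  have "abelian_group (ext M)"
  proof (rule abelian_groupI)
    fix y assume "y \<in> carrier (ext M)"
    then obtain m where "m \<in> carrier M" "y = (m, \<lambda>_. undefined)"
      by (auto simp: extend_simps)
    then show "\<exists>z\<in>carrier (ext M). z \<oplus>\<^bsub>ext M\<^esub> y = \<zero>\<^bsub>ext M\<^esub>"
      by (intro bexI[of _ "(\<ominus>\<^bsub>M\<^esub> m, \<lambda>_. undefined)"]) (auto simp: extend_simps M.M.l_neg)
  qed (auto simp: extend_simps M.M.a_ac)
  then show ?thesis
    by (intro left_module.intro left_module_axioms.intro ring_B)
      (auto simp: extend_simps B_simps M.smult_closed M.smult_l_distr M.smult_r_distr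
        M.smult_assoc1 M.smult_one)
qed

abbreviation inA where "inA a \<equiv> (a, \<zero>\<^bsub>V\<^esub>, \<zero>\<^bsub>K\<^esub>)"
abbreviation inK where "inK c \<equiv> (\<zero>\<^bsub>A\<^esub>, \<zero>\<^bsub>V\<^esub>, c)"

lemma semilinear_bij_extend:
  assumes "left_module A M"
  shows "semilinear_bij inA (\<lambda>m. (m, \<lambda>_. undefined)) A M B (ext M)"
proof -
  interpret M: left_module A M by fact
  show ?thesis
    using assms left_module_extend[OF assms]
    by (auto simp: semilinear_bij_def extend_simps B_simps bij_betw_def inj_on_def M.smult_closed)
qed

text \<open>A linear map over \<open>A\<close> lifts because \<open>(a, x, c)\<close> acts on
  \<open>ext M\<close> through \<open>a\<close> alone. This makes the class of \<open>ext M\<close>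
  depend only on the class of \<open>M\<close>.\<close>

lemma module_iso_extend:
  assumes "module_iso A M N" "left_module A M" "left_module A N"
  shows "module_iso B (ext M) (ext N)"
proof -
  interpret M: left_module A M by fact
  interpret N: left_module A N by fact
  obtain h where h: "h \<in> module_hom A M N" "bij_betw h (carrier M) (carrier N)"
    using assms by (auto simp: module_iso_def)
  let ?h = "\<lambda>y\<in>carrier (ext M). (h (fst y), \<lambda>_. undefined)"
  have "?h \<in> module_hom B (ext M) (ext N)"
    by (rule module_homI)
      (auto simp: extend_simps B_simps module_homD[OF h(1)] M.smult_closed N.smult_closed)
  moreover have "bij_betw ?h (carrier (ext M)) (carrier (ext N))"
  proof (rule bij_betw_imageI)
    have "carrier N = h ` carrier M"
      using h(2) by (simp add: bij_betw_def)
    then show "?h ` carrier (ext M) = carrier (ext N)"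
      by (auto simp: extend_simps image_iff)
  qed (use h(2) in \<open>auto simp: bij_betw_def inj_on_def extend_simps\<close>)
  ultimately show ?thesis by (rule module_isoI)
qed

section \<open>The simple module at the extension point\<close>

abbreviation S_a :: "('a \<times> 'x \<times> 'k, 'm \<times> (nat \<Rightarrow> 'k)) module" where
  "S_a \<equiv> extension_simple K"

text \<open>The scalar \<open>c\<close> as a vector of the one-dimensional space at
  \<open>a\<close>; \<open>undefined\<close> is the sole element of
  \<open>zero_module\<close>.\<close>

abbreviation (input) line :: "'k \<Rightarrow> 'm \<times> (nat \<Rightarrow> 'k)" where
  "line c \<equiv> (undefined, \<lambda>i\<in>{..<1}. c)"

lemma S_a_simps:
  "carrier S_a = line ` carrier K"
  "\<zero>\<^bsub>S_a\<^esub> = line \<zero>\<^bsub>K\<^esub>"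
  "line c \<oplus>\<^bsub>S_a\<^esub> line d = line (c \<oplus>\<^bsub>K\<^esub> d)"
  "(a, x, c) \<odot>\<^bsub>S_a\<^esub> line d = line (c \<otimes>\<^bsub>K\<^esub> d)"
proof -
  \<comment> \<open>A vector of length one is constant on its index set, with value
    \<open>v 0\<close>.\<close>
  have "v \<in> (\<lambda>c. \<lambda>i\<in>{..<1}. c) ` carrier K" if v: "v \<in> {..<1::nat} \<rightarrow>\<^sub>E carrier K" for v
  proof (rule image_eqI)
    have "v \<in> extensional {..<1}" using v by (simp add: PiE_def)
    then show "v = (\<lambda>i\<in>{..<1}. v 0)"
      by (rule extensionalityI) simp_all
    show "v 0 \<in> carrier K" using v by (rule PiE_mem) simp
  qed
  moreover have "(\<lambda>i\<in>{..<1}. c) \<in> {..<1::nat} \<rightarrow>\<^sub>E carrier K" if "c \<in> carrier K" for c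
    using that by simp
  ultimately have PiE: "({..<1::nat} \<rightarrow>\<^sub>E carrier K) = (\<lambda>c. \<lambda>i\<in>{..<1}. c) ` carrier K"
    by (intro subset_antisym subsetI image_subsetI)
  have "carrier S_a = {undefined} \<times> ({..<1} \<rightarrow>\<^sub>E carrier K)"
    by (simp add: extension_simple_def triple_module_def zero_module_def)
  then show "carrier S_a = line ` carrier K"
    unfolding PiE by auto
  show "\<zero>\<^bsub>S_a\<^esub> = line \<zero>\<^bsub>K\<^esub>"
    by (simp add: extension_simple_def triple_module_def zero_module_def)
  show "line c \<oplus>\<^bsub>S_a\<^esub> line d = line (c \<oplus>\<^bsub>K\<^esub> d)"
    by (simp add: extension_simple_def triple_module_def zero_module_def cong: restrict_cong)
  show "(a, x, c) \<odot>\<^bsub>S_a\<^esub> line d = line (c \<otimes>\<^bsub>K\<^esub> d)"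
    by (simp add: extension_simple_def triple_module_def zero_module_def cong: restrict_cong)
qed

lemma line_eq_iff: "line c = line d \<longleftrightarrow> c = d"
  by (auto simp: restrict_def fun_eq_iff)

lemma left_module_S_a: "left_module B S_a"
proof -
  have "abelian_group S_a"
  proof (rule abelian_groupI)
    fix y assume "y \<in> carrier S_a"
    then obtain c where "c \<in> carrier K" "y = line c"
      by (auto simp only: S_a_simps)
    then show "\<exists>z\<in>carrier S_a. z \<oplus>\<^bsub>S_a\<^esub> y = \<zero>\<^bsub>S_a\<^esub>"
      by (intro bexI[of _ "line (\<ominus>\<^bsub>K\<^esub> c)"])
        (auto simp only: S_a_simps A.R.l_neg A.R.a_inv_closed intro!: imageI)
  qed (auto simp only: S_a_simps A.R.a_ac A.R.l_zero A.R.r_zero A.R.zero_closed A.R.add.m_closed intro!: imageI)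
  then show ?thesis
    by (intro left_module.intro left_module_axioms.intro ring_B)
      (auto simp only: S_a_simps B_simps A.R.m_closed A.R.l_distr A.R.r_distr A.R.m_assoc A.R.l_one mem_Sigma_iff
        intro!: imageI)
qed

abbreviation (input) K1 where "K1 \<equiv> principal_left_module K \<one>\<^bsub>K\<^esub>"

lemma semilinear_bij_S_a: "semilinear_bij inK line K K1 B S_a"
proof -
  have "bij_betw line (carrier K) (carrier S_a)"
    unfolding bij_betw_def by (auto simp only: S_a_simps inj_on_def line_eq_iff)
  moreover have "line (x \<oplus>\<^bsub>K1\<^esub> y) = line x \<oplus>\<^bsub>S_a\<^esub> line y"
    "line (x \<odot>\<^bsub>K1\<^esub> y) = inK x \<odot>\<^bsub>S_a\<^esub> line y" for x y
    by (simp_all only: S_a_simps) (simp_all add: principal_left_module_simps)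
  ultimately show ?thesis
    unfolding semilinear_bij_def A.R.carrier_self
    using A.R.left_module_self left_module_S_a by (auto simp: B_simps)
qed

section \<open>Isomorphism classes and Hom spaces over the extension\<close>

lemma fg_extend: "fg_left_module A M \<Longrightarrow> fg_left_module B (extend_by_zero K M)"
  unfolding fg_left_module_def
  using semilinear_bij_fin_gen[OF semilinear_bij_extend] left_module_extend by blast

lemma fg_S_a: "fg_left_module B S_a"
  unfolding fg_left_module_def
  using semilinear_bij_fin_gen[OF semilinear_bij_S_a] A.R.fin_gen_self left_module_S_a
  by blast

lemma iso_class_extendE:
  assumes "N \<in> iso_class B (extend_by_zero K M)" "left_module A M"
  obtains \<phi> where "semilinear_bij inA \<phi> A M B N"
  using semilinear_bij_module_iso[OF semilinear_bij_extend[OF assms(2)]] assms(1)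
  by (auto simp: iso_class_def fg_left_module_def)

lemma iso_class_S_aE:
  assumes "N \<in> iso_class B S_a"
  obtains \<phi> where "semilinear_bij inK \<phi> K K1 B N"
  using semilinear_bij_module_iso[OF semilinear_bij_S_a] assms
  by (auto simp: iso_class_def fg_left_module_def)

lemma inA_inK_orthogonal:
  "inA \<one>\<^bsub>A\<^esub> \<otimes>\<^bsub>B\<^esub> inK \<one>\<^bsub>K\<^esub> = \<zero>\<^bsub>B\<^esub>" "inK \<one>\<^bsub>K\<^esub> \<otimes>\<^bsub>B\<^esub> inA \<one>\<^bsub>A\<^esub> = \<zero>\<^bsub>B\<^esub>"
  by (simp_all add: B_simps V_simps)

lemma hom_S_a_zero:
  assumes \<phi>: "semilinear_bij inA \<phi> A M B M'" and \<psi>: "semilinear_bij inK \<psi> K K1 B N'"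
  shows "module_hom B M' N' = {zero_hom M' N'}" "module_hom B N' M' = {zero_hom N' M'}"
proof -
  note mods = semilinear_bijD(2)[OF \<phi>] semilinear_bijD(2)[OF \<psi>]
  note ids = semilinear_bij_one_acts_as_id[OF \<phi>] semilinear_bij_one_acts_as_id[OF \<psi>]
  have mem: "inA \<one>\<^bsub>A\<^esub> \<in> carrier B" "inK \<one>\<^bsub>K\<^esub> \<in> carrier B"
    by (simp_all add: B_simps)
  show "module_hom B M' N' = {zero_hom M' N'}"
    using mods mem inA_inK_orthogonal(1) ids by (rule module_hom_orthogonal_idempotents)
  show "module_hom B N' M' = {zero_hom N' M'}"
    using mods(2,1) mem(2,1) inA_inK_orthogonal(2) ids(2,1)
    by (rule module_hom_orthogonal_idempotents)
qed

lemma division_algebra_End_B: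
  assumes "semilinear_bij \<sigma> \<phi> R M B N" "brick R M"
  shows "division_algebra K (End_algebra B N)"
proof -
  interpret algebra_module K B N
    using assoc_algebra_B semilinear_bijD(2)[OF assms(1)] by (rule algebra_module.intro)
  show ?thesis
    using semilinear_bij_brick[OF assms] by (simp add: division_algebra_End_iff)
qed

lemma division_algebra_End_A:
  assumes "left_module A M"
  shows "division_algebra K (End_algebra A M) \<longleftrightarrow> brick A M"
  using algebra_module.division_algebra_End_iff[OF algebra_module.intro] A.assoc_algebra_axioms assms
  by blast

end

section \<open>Semibricks over the algebra and over its extension\<close>

lemma semibrickD_fg:
  assumes "semibrick K L \<S>" "C \<in> \<S>" "M \<in> C"
  shows "fg_left_module L M"
  using assms by (auto simp: semibrick_def iso_classes_def iso_class_def)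

lemma semibrickD_hom:
  assumes "semibrick K L \<S>" "C \<in> \<S>" "D \<in> \<S>" "C \<noteq> D" "M \<in> C" "N \<in> D"
  shows "module_hom L M N = {zero_hom M N}"
  using assms by (simp add: semibrick_def)

lemma semibrickD_iso:
  assumes "semibrick K L \<S>" "C \<in> \<S>" "M \<in> C" "N \<in> C"
  shows "module_iso L M N"
proof -
  obtain P where "fg_left_module L P" "C = iso_class L P"
    using assms(1,2) by (auto simp: semibrick_def iso_classes_def)
  with assms(3,4) show ?thesis
    using module_iso_trans module_iso_sym by (fastforce simp: iso_class_def fg_left_module_def)
qed

theorem proposition1p1:
  fixes K :: "'k ring"
    and A :: "('k, 'a) module"
    and V :: "('a, 'x) module"
    and B :: "('k, 'a \<times> 'x \<times> 'k) module"
    and \<S> :: "('a, 'm) module set set"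
  assumes "algebraically_closed K"
    and "fd_algebra K A" and "basic A" and "connected_algebra A"
    and "fg_left_module A V"
    and "B = one_point_extension K A V"
    and "basic B" and "connected_algebra B"
    and "semibrick K A \<S>"
  shows "semibrick K B (extend_classes K B \<S>) \<and>
         semibrick K B (extend_classes K B \<S> \<union> {iso_class B (extension_simple K)})"
proof -
  interpret extension_data K A V
    using assms(2,5) by (auto simp: extension_data_def fd_algebra_def fg_left_module_def)
  note B = assms(6) and sb = assms(9)
  have ext_class: "\<exists>C0 M. C0 \<in> \<S> \<and> M \<in> C0 \<and> left_module A M \<and> fg_left_module A M \<and>
      C = iso_class B (extend_by_zero K M)" if "C \<in> extend_classes K B \<S>" for C
    using that semibrickD_fg[OF sb] by (fastforce simp: extend_classes_def fg_left_module_def)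
  \<comment> \<open>Every condition in \<open>semibrick\<close> passes to subsets, so all of them
    are proved for the larger set; \<open>UnI1\<close> then yields the first conjunct.\<close>
  let ?T = "extend_classes K B \<S> \<union> {iso_class B (extension_simple K)}"
  have classes: "C \<in> iso_classes B" if C: "C \<in> ?T" for C
  \<comment> \<open>Splitting by equality with the class of \<open>S_a\<close>, here and below,
    avoids having to decide whether that class lies in
    \<open>extend_classes K B \<S>\<close>.\<close>
  proof (cases "C = iso_class B (extension_simple K)")
    case True
    then show ?thesis using fg_S_a B by (auto simp: iso_classes_def)
  next
    case False
    then obtain M where "fg_left_module A M" "C = iso_class B (extend_by_zero K M)"
      using C ext_class by blast
    then show ?thesis using fg_extend B by (auto simp: iso_classes_def)
  qed
  have bricks: "division_algebra K (End_algebra B N)" if C: "C \<in> ?T" and N: "N \<in> C" for C N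
  proof (cases "C = iso_class B (extension_simple K)")
    case True
    obtain \<phi> where "semilinear_bij inK \<phi> K K1 B N"
      using N unfolding True B by (rule iso_class_S_aE)
    then show ?thesis
      unfolding B using A.brick_self by (rule division_algebra_End_B)
  next
    case False
    then obtain C0 M where M: "C0 \<in> \<S>" "M \<in> C0" "left_module A M"
      and CM: "C = iso_class B (extend_by_zero K M)"
      using C ext_class by blast
    obtain \<phi> where \<phi>: "semilinear_bij inA \<phi> A M B N"
      using N M(3) unfolding CM B by (rule iso_class_extendE)
    have "brick A M"
      using sb M(1,2) unfolding division_algebra_End_A[OF M(3), symmetric] semibrick_def by blast
    with \<phi> show ?thesis
      unfolding B by (rule division_algebra_End_B)
  qed
  have hom_zero: "module_hom B M' N' = {zero_hom M' N'}"
    if C: "C \<in> ?T" and D: "D \<in> ?T" and ne: "C \<noteq> D" and M': "M' \<in> C" and N': "N' \<in> D"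
    for C D M' N'
  proof -
    have ext: "\<exists>C0 M \<phi>. C0 \<in> \<S> \<and> M \<in> C0 \<and> left_module A M \<and>
        C = iso_class B (extend_by_zero K M) \<and> semilinear_bij inA \<phi> A M B M'"
      if C: "C \<in> ?T" "C \<noteq> iso_class B (extension_simple K)" and M': "M' \<in> C" for C M'
    proof -
      obtain C0 M where M: "C0 \<in> \<S>" "M \<in> C0" "left_module A M"
        and CM: "C = iso_class B (extend_by_zero K M)"
        using C ext_class by blast
      moreover obtain \<phi> where "semilinear_bij inA \<phi> A M B M'"
        using M' M(3) unfolding CM B by (rule iso_class_extendE)
      ultimately show ?thesis by blast
    qed
    consider "C = iso_class B (extension_simple K)" "D \<noteq> iso_class B (extension_simple K)"
      | "C \<noteq> iso_class B (extension_simple K)" "D = iso_class B (extension_simple K)"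
      | "C \<noteq> iso_class B (extension_simple K)" "D \<noteq> iso_class B (extension_simple K)"
      using ne by blast
    then show ?thesis
    proof cases
      case 1
      show ?thesis
      proof -
        obtain N :: "('a, 'm) module" and \<psi> where "semilinear_bij inA \<psi> A N B N'"
          using ext[OF D 1(2) N'] by blast
        moreover obtain \<phi> where "semilinear_bij inK \<phi> K K1 B M'"
          using M' unfolding 1 B by (rule iso_class_S_aE)
        ultimately show ?thesis
          unfolding B by (rule hom_S_a_zero(2))
      qed
    next
      case 2
      show ?thesis
      proof -
        obtain M :: "('a, 'm) module" and \<phi> where "semilinear_bij inA \<phi> A M B M'"
          using ext[OF C 2(1) M'] by blast
        moreover obtain \<psi> where "semilinear_bij inK \<psi> K K1 B N'"
          using N' unfolding 2 B by (rule iso_class_S_aE)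
        ultimately show ?thesis
          unfolding B by (rule hom_S_a_zero(1))
      qed
    next
      case 3
      obtain C0 M \<phi> where M: "C0 \<in> \<S>" "M \<in> C0" "left_module A M"
        "C = iso_class B (extend_by_zero K M)" "semilinear_bij inA \<phi> A M B M'"
        using ext[OF C 3(1) M'] by blast
      obtain D0 N \<psi> where N: "D0 \<in> \<S>" "N \<in> D0" "left_module A N"
        "D = iso_class B (extend_by_zero K N)" "semilinear_bij inA \<psi> A N B N'"
        using ext[OF D 3(2) N'] by blast
      \<comment> \<open>Vanishing over \<open>A\<close> is available only between different members
        of \<open>\<S>\<close>. If these coincided, \<open>M\<close> and \<open>N\<close> would be
        isomorphic, hence so would their extensions, contradicting
        \<open>C \<noteq> D\<close>.\<close>
      have "C0 \<noteq> D0"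
      proof
        assume "C0 = D0"
        then have "module_iso A M N"
          using semibrickD_iso[OF sb] M N by blast
        then have "C = D"
          unfolding M(4) N(4) B
          by (intro iso_class_eqI module_iso_extend left_module_extend M(3) N(3))
        with ne show False ..
      qed
      then have "module_hom A M N = {zero_hom M N}"
        using sb M(1,2) N(1,2) semibrickD_hom by metis
      with M(5) N(5) show ?thesis by (rule semilinear_bij_hom_zero)
    qed
  qed
  show ?thesis
    unfolding semibrick_def
    by (intro conjI subsetI ballI impI; (rule classes bricks hom_zero)?) (erule UnI1 | assumption)+
qed

end
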